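(* Let $(\mathfrak{A},\omega,\tau,K)$ be a $\ast$-dynamical system, where $K$ is a Borel measurable subsemigroup of a locally compact Hausdorff group $G$ with right Haar measure $\mu$. Assume that $K$ is abelian (i.e. $gh=hg$ for all $g,h\in K$) and that $\omega(\tau_{g}(A)^{\ast}\tau_{g}(B))=\omega(A^{\ast}B)$ for all $A,B\in\mathfrak{A}$ and $g\in K$. Let $q$ be a positive integer and, for $j=1,\ldots,q$, let $\varphi_{j}:K\rightarrow K$ be a Borel measurable function such that $\varphi_{j}(gh)=\varphi_{j}(g)\varphi_{j}(h)$ for all $g,h\in K$. Let $\{\Lambda_{\alpha}\}$ be a space-filling net in $K$. Then for any $A,B\in\mathfrak{A}$ and $\varepsilon>0$ there exists an $\alpha_{0}$ such that $$\left|\frac{1}{\mu(\Lambda_{\alpha_{0}})}\int_{\Lambda_{\alpha_{0}}h}\omega(A^{\ast}\tau_{\varphi_{1}(g)}(B))\cdots\omega(A^{\ast}\tau_{\varphi_{q}(g)}(B))\,d\mu(g)\right|>\left|\lim_{\alpha}\frac{1}{\mu(\Lambda_{\alpha})}\int_{\Lambda_{\alpha}}\omega(A^{\ast}\tau_{\varphi_{1}(g)}(B))\cdots\omega(A^{\ast}\tau_{\varphi_{q}(g)}(B))\,d\mu(g)\right|-\varepsilon$$ for all $h\in K$ (the existence of the limit on the right being part of the assertion). In particular, if $A=B$, then for every $h\in K$ $$\left|\omega(A^{\ast}\tau_{\varphi_{1}(g)}(A))\cdots\omega(A^{\ast}\tau_{\varphi_{q}(g)}(A))\right|>|\omega(A)|^{2q}-\varepsilon$$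 for some $g\in\Lambda_{\alpha_{0}}h$.
   Context: A subsemigroup of a group $G$ is a subset $K\subset G$ (with $K=G$ allowed) such that $gh\in K$ for all $g,h\in K$. $\ast$-dynamical system: Let $\omega$ be a state on a (complex) unital $\ast$-algebra $\mathfrak{A}$, i.e. a linear functional with $\omega(A^{\ast}A)\geq 0$ for all $A\in\mathfrak{A}$ and $\omega(1)=1$. Let $G$ be a locally compact Hausdorff group with right Haar measure $\mu$, and $K$ a Borel measurable subsemigroup of $G$. Let $L(\mathfrak{A})$ be the space of linear operators $\mathfrak{A}\to\mathfrak{A}$, and let $\tau:K\rightarrow L(\mathfrak{A}):g\mapsto\tau_{g}$ satisfy $\tau_{g}\circ\tau_{h}=\tau_{gh}$, $\tau_{g}(1)=1$ and $\omega(\tau_{g}(A)^{\ast}\tau_{g}(A))\leq\omega(A^{\ast}A)$ for all $g,h\in K$ and $A\in\mathfrak{A}$, and be such that $K\ni g\mapsto\omega(A^{\ast}\tau_{g}(B))$ is Borel measurable for all $A,B\in\mathfrak{A}$. Then $(\mathfrak{A},\omega,\tau,K)$ is called a $\ast$-dynamical system. A net $\{\Lambda_{\alpha}\}$ is a family of subsets of $G$ indexed by a directed set. A net $\{\Lambda_{\alpha}\}$ of Borel subsets of $G$ is called space-filling in $K$ if $\Lambda_{\alpha}\subset K$ and $\mu(\Lambda_{\alpha})<\infty$ for all $\alpha$, $\mu(\Lambda_{\alpha})>0$ for all $\alpha$ large enough (i.e. for all $\alpha\geq\alpha_{1}$, for some $\alpha_{1}$), and $$\lim_{\alpha}\frac{\mu(\Lambda_{\alpha}\Delta(\Lambda_{\alpha}g))}{\mu(\Lambda_{\alpha})}=0$$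 for all $g\in K$, where $A\Delta B:=(A\cup B)\setminus(A\cap B)$ and $\Lambda g:=\{kg:k\in\Lambda\}$. Whenever $1/\mu(\Lambda_{\alpha_0})$ is written, it is understood that $\mu(\Lambda_{\alpha_0})>0$. *)

theory Defs
  imports "HOL-Analysis.Analysis" "HOL-Library.Complex_Order"
begin

(* The class ring_1 excludes the zero ring, which carries no state:
   omega 1 = 1 forces 1 to be nonzero. *)
locale unital_star_algebra = vector_space scale
  for scale :: "complex \<Rightarrow> 'a::ring_1 \<Rightarrow> 'a" +
  fixes star :: "'a \<Rightarrow> 'a"
  assumes scale_mult_left: "scale c A * B = scale c (A * B)"
    and scale_mult_right: "A * scale c B = scale c (A * B)"
    and star_star: "star (star A) = A"
    and star_add: "star (A + B) = star A + star B"
    and star_scale: "star (scale c A) = scale (cnj c) (star A)"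
    and star_mult: "star (A * B) = star B * star A"

(* Here and below, an inequality between complex numbers (Complex_Order) says that
   the imaginary parts agree and the real parts satisfy the inequality. *)
locale star_algebra_state = unital_star_algebra scale star
  for scale :: "complex \<Rightarrow> 'a::ring_1 \<Rightarrow> 'a" and star :: "'a \<Rightarrow> 'a" +
  fixes \<omega> :: "'a \<Rightarrow> complex"
  assumes linear_state: "Vector_Spaces.linear scale (*) \<omega>"
    and state_nonneg: "0 \<le> \<omega> (star A * A)"
    and state_one: "\<omega> 1 = 1"

(* Groups are written additively throughout, as in the class topological_group_add,
   which does not require commutativity: g + h is the product gh. *)

definition subsemigroup :: "'g::group_add set \<Rightarrow> bool" where
  "subsemigroup K \<longleftrightarrow> (\<forall>g\<in>K. \<forall>h\<in>K. g + h \<in> K)"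

(* tau is only relevant on K; its values outside K are arbitrary. *)
locale star_dynamical_system = star_algebra_state scale star \<omega>
  for scale :: "complex \<Rightarrow> 'a::ring_1 \<Rightarrow> 'a" and star :: "'a \<Rightarrow> 'a"
    and \<omega> :: "'a \<Rightarrow> complex" +
  fixes \<tau> :: "'g::{topological_group_add, t2_space} \<Rightarrow> 'a \<Rightarrow> 'a"
    and K :: "'g set"
  assumes subsemigroup_K: "subsemigroup K"
    and borel_K: "K \<in> sets borel"
    and linear_tau: "g \<in> K \<Longrightarrow> Vector_Spaces.linear scale scale (\<tau> g)"
    and tau_comp: "g \<in> K \<Longrightarrow> h \<in> K \<Longrightarrow> \<tau> g \<circ> \<tau> h = \<tau> (g + h)"
    and tau_one: "g \<in> K \<Longrightarrow> \<tau> g 1 = 1"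
    and tau_contractive: "g \<in> K \<Longrightarrow> \<omega> (star (\<tau> g A) * \<tau> g A) \<le> \<omega> (star A * A)"
    and measurable_tau: "(\<lambda>g. \<omega> (star A * \<tau> g B)) \<in> borel_measurable (restrict_space borel K)"

(* A right Haar measure is a nonzero right-invariant Radon measure, with the usual
   regularity convention: outer regular on Borel sets, inner regular on open sets. *)
definition right_haar_measure :: "'g::{topological_group_add, t2_space} measure \<Rightarrow> bool" where
  "right_haar_measure \<mu> \<longleftrightarrow>
     sets \<mu> = sets borel \<and>
     emeasure \<mu> UNIV \<noteq> 0 \<and>
     (\<forall>C. compact C \<longrightarrow> emeasure \<mu> C < \<infinity>) \<and>
     (\<forall>E\<in>sets borel. emeasure \<mu> E = (INF U\<in>{U. open U \<and> E \<subseteq> U}. emeasure \<mu> U)) \<and>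
     (\<forall>U. open U \<longrightarrow> emeasure \<mu> U = (SUP C\<in>{C. compact C \<and> C \<subseteq> U}. emeasure \<mu> C)) \<and>
     (\<forall>E\<in>sets borel. \<forall>g. emeasure \<mu> ((\<lambda>k. k + g) ` E) = emeasure \<mu> E)"

class directed_preorder = preorder +
  assumes directed: "\<exists>k. i \<le> k \<and> j \<le> k"

(* The library filter at_top would require an antisymmetric order on the index set. *)
definition net_filter :: "'i::directed_preorder filter" where
  "net_filter = (INF i. principal {i..})"

lemma eventually_net_filter:
  "eventually P (net_filter :: 'i::directed_preorder filter) \<longleftrightarrow> (\<exists>i0. \<forall>i\<ge>i0. P i)"
proof -
  have "eventually P (net_filter :: 'i filter) \<longleftrightarrow> (\<exists>i\<in>UNIV. eventually P (principal {i::'i..}))"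
    unfolding net_filter_def
  proof (rule eventually_INF_base)
    fix a b :: 'i
    obtain k where "a \<le> k" "b \<le> k"
      using directed[of a b] by blast
    then show "\<exists>x\<in>UNIV. principal {x..} \<le> inf (principal {a..}) (principal {b..})"
      by (intro bexI[of _ k]) (auto intro: order_trans)
  qed simp
  then show ?thesis
    by (simp add: eventually_principal Ball_def)
qed

lemma net_filter_neq_bot: "(net_filter :: 'i::directed_preorder filter) \<noteq> bot"
  by (auto simp: trivial_limit_def eventually_net_filter)

definition space_filling ::
    "'g::{topological_group_add, t2_space} measure \<Rightarrow> 'g set \<Rightarrow> ('i::directed_preorder \<Rightarrow> 'g set) \<Rightarrow> bool" where
  "space_filling \<mu> K \<Lambda> \<longleftrightarrow>
     (\<forall>\<alpha>. \<Lambda> \<alpha> \<in> sets borel \<and> \<Lambda> \<alpha> \<subseteq> K \<and> emeasure \<mu> (\<Lambda> \<alpha>) < \<infinity>) \<and>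
     eventually (\<lambda>\<alpha>. 0 < emeasure \<mu> (\<Lambda> \<alpha>)) net_filter \<and>
     (\<forall>g\<in>K. ((\<lambda>\<alpha>. measure \<mu> (sym_diff (\<Lambda> \<alpha>) ((\<lambda>k. k + g) ` \<Lambda> \<alpha>)) / measure \<mu> (\<Lambda> \<alpha>))
               \<longlongrightarrow> 0) net_filter)"

end

theory Submission
  imports Defs
begin

text \<open>
  The integrand is \<open>\<langle>a, U\<^sub>g b\<rangle>\<close> for the isometries \<open>U\<^sub>g\<close> induced by
  \<open>\<tau>\<^bsub>\<phi>\<^sub>1(g)\<^esub>, \<dots>, \<tau>\<^bsub>\<phi>\<^sub>q(g)\<^esub>\<close> on the \<open>q\<close>-fold tensor power of the GNS space, whose
  inner product is, on elementary tensors, a pointwise product of positive kernels. A uniform average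
  \<open>c\<close> of finitely many \<open>U\<^sub>h b\<close> with almost minimal norm is almost fixed by all \<open>U\<^sub>g\<close>. Since the net
  is asymptotically invariant, the averages of \<open>\<langle>a, U\<^sub>g b\<rangle>\<close> over all translates of \<open>\<Lambda>\<^sub>\<alpha>\<close> are
  eventually close to \<open>\<langle>a, c\<rangle>\<close>, uniformly in the translate, because \<open>K\<close> is commutative. No
  completion of the tensor product and no vector-valued integral is needed.
\<close>

section \<open>Positive definite kernels\<close>

text \<open>A list of pairs stands for a formal linear combination of points, and this is the
  sesquilinear form, antilinear in the first argument, that extends \<open>k\<close> to them.
  Addition is \<open>@\<close> and scaling is a \<open>map\<close>; repeated points are
  harmless.\<close>

definition kernel_form ::
    "('s \<Rightarrow> 's \<Rightarrow> complex) \<Rightarrow> (complex \<times> 's) list \<Rightarrow> (complex \<times> 's) list \<Rightarrow> complex" where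
  "kernel_form k v w = (\<Sum>(c, x)\<leftarrow>v. \<Sum>(d, y)\<leftarrow>w. cnj c * d * k x y)"

text \<open>The order on complex numbers makes every diagonal value of the form real, which is why
  Hermitian symmetry can be derived below.\<close>

definition positive_kernel :: "('s \<Rightarrow> 's \<Rightarrow> complex) \<Rightarrow> bool" where
  "positive_kernel k \<longleftrightarrow> (\<forall>v. 0 \<le> kernel_form k v v)"

section \<open>Sesquilinearity of the form and operations on the kernel\<close>

lemma kernel_form_Nil [simp]: "kernel_form k [] w = 0" "kernel_form k v [] = 0"
  by (auto simp: kernel_form_def case_prod_unfold)

lemma kernel_form_append_left:
  "kernel_form k (v @ v') w = kernel_form k v w + kernel_form k v' w"
  by (simp add: kernel_form_def)

lemma kernel_form_append_right:
  "kernel_form k v (w @ w') = kernel_form k v w + kernel_form k v w'"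
  by (simp add: kernel_form_def case_prod_unfold sum_list_addf)

lemma kernel_form_Cons_left: "kernel_form k (p # v) w = kernel_form k [p] w + kernel_form k v w"
  using kernel_form_append_left[of k "[p]" v w] by simp

lemma kernel_form_Cons_right: "kernel_form k v (p # w) = kernel_form k v [p] + kernel_form k v w"
  using kernel_form_append_right[of k v "[p]" w] by simp

lemma kernel_form_singleton: "kernel_form k [(c, x)] [(d, y)] = cnj c * d * k x y"
  by (simp add: kernel_form_def)

lemma kernel_form_scale_left:
  "kernel_form k (map (\<lambda>(c, x). (s * c, x)) v) w = cnj s * kernel_form k v w"
  by (induction v)
    (simp_all add: kernel_form_def case_prod_unfold distrib_left sum_list_const_mult mult.assoc)

lemma kernel_form_scale_right:
  "kernel_form k v (map (\<lambda>(c, x). (s * c, x)) w) = s * kernel_form k v w"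
  by (induction v)
    (simp_all add: kernel_form_def case_prod_unfold o_def distrib_left sum_list_const_mult mult_ac)

lemma kernel_form_add:
  "kernel_form (\<lambda>x y. k x y + l x y) v w = kernel_form k v w + kernel_form l v w"
  by (simp add: kernel_form_def case_prod_unfold distrib_left sum_list_addf)

lemma kernel_form_cmult: "kernel_form (\<lambda>x y. s * k x y) v w = s * kernel_form k v w"
  by (induction v)
    (simp_all add: kernel_form_def case_prod_unfold distrib_left sum_list_const_mult mult_ac)

text \<open>Congruence by a diagonal matrix: the factors \<open>r\<close> move from the kernel into
  the coefficients.\<close>

lemma kernel_form_twist:
  "kernel_form (\<lambda>x y. cnj (r x) * r y * k x y) v w =
     kernel_form k (map (\<lambda>(c, x). (r x * c, x)) v) (map (\<lambda>(c, x). (r x * c, x)) w)"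
  by (simp add: kernel_form_def case_prod_unfold o_def mult_ac)

lemma kernel_form_pullback:
  "kernel_form (\<lambda>x y. k (p x) (p y)) v w = kernel_form k (map (apsnd p) v) (map (apsnd p) w)"
  by (simp add: kernel_form_def case_prod_unfold o_def)

lemma positive_kernel_pullback: "positive_kernel k \<Longrightarrow> positive_kernel (\<lambda>x y. k (p x) (p y))"
  by (simp add: positive_kernel_def kernel_form_pullback)

section \<open>Hermitian symmetry and the Cauchy-Schwarz inequality\<close>

lemma positive_kernel_sym:
  assumes "positive_kernel k"
  shows "k y x = cnj (k x y)"
proof -
  have diag: "Im (k z z) = 0" for z
    using assms[unfolded positive_kernel_def, rule_format, of "[(1, z)]"]
    by (simp add: kernel_form_singleton less_eq_complex_def)
  have "0 \<le> k x x + c * k x y + cnj c * k y x + cnj c * c * k y y" for c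
    using assms[unfolded positive_kernel_def, rule_format, of "[(1, x), (c, y)]"]
    by (simp add: kernel_form_def algebra_simps)
  \<comment> \<open>Realness at \<open>c = 1\<close> gives opposite imaginary parts of
    \<open>k x y\<close> and \<open>k y x\<close>; realness at \<open>c = \<i>\<close> gives equal
    real parts.\<close>
  from this[of 1] this[of \<i>] show ?thesis
    by (simp add: less_eq_complex_def complex_eq_iff diag)
qed

lemma kernel_form_sym:
  assumes "positive_kernel k"
  shows "kernel_form k w v = cnj (kernel_form k v w)"
proof -
  have single: "kernel_form k w [p] = cnj (kernel_form k [p] w)" for p w
  proof (induction w)
    case (Cons q w)
    have "kernel_form k [q] [p] = cnj (kernel_form k [p] [q])"
      using positive_kernel_sym[OF assms, of "snd q" "snd p"]
      by (cases p; cases q) (simp add: kernel_form_singleton mult_ac)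
    then show ?case
      using Cons by (subst kernel_form_Cons_left, subst kernel_form_Cons_right) simp
  qed simp
  show ?thesis
  proof (induction v)
    case (Cons p v)
    then show ?case
      using single[of w p] by (subst kernel_form_Cons_left, subst kernel_form_Cons_right) simp
  qed simp
qed

lemma kernel_form_self:
  assumes "positive_kernel k"
  shows "kernel_form k v v = of_real (Re (kernel_form k v v))" "0 \<le> Re (kernel_form k v v)"
  using assms by (auto simp: positive_kernel_def less_eq_complex_def complex_eq_iff)

lemma positive_kernel_diag:
  assumes "positive_kernel k"
  shows "k x x = of_real (Re (k x x))" "0 \<le> Re (k x x)"
  using kernel_form_self[OF assms, of "[(1, x)]"] by (simp_all add: kernel_form_singleton)

lemma kernel_form_Cauchy_Schwarz:
  assumes "positive_kernel k"
  shows "(cmod (kernel_form k v w))\<^sup>2 \<le> Re (kernel_form k v v) * Re (kernel_form k w w)"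
proof -
  define z where "z = kernel_form k w v"
  define V where "V = Re (kernel_form k v v)"
  define W where "W = Re (kernel_form k w w)"
  have vw: "kernel_form k v w = cnj z"
    unfolding z_def by (rule kernel_form_sym[OF assms])
  have zz: "z * cnj z = of_real ((cmod z)\<^sup>2)"
    using complex_norm_square[of z] by simp
  have VW: "kernel_form k v v = of_real V" "kernel_form k w w = of_real W"
    unfolding V_def W_def by (rule kernel_form_self(1)[OF assms])+
  \<comment> \<open>Positivity at the vector v - t z w; the coefficient \<open>z\<close> makes the
    cross terms real, leaving a real quadratic in \<open>t\<close>.\<close>
  have main: "0 \<le> V - 2 * t * (cmod z)\<^sup>2 + t\<^sup>2 * (cmod z)\<^sup>2 * W" for t :: real
  proof -
    let ?u = "v @ map (\<lambda>(c, x). (of_real (- t) * z * c, x)) w"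
    have "kernel_form k ?u ?u = of_real V - 2 * of_real t * (z * cnj z)
        + (of_real t)\<^sup>2 * (z * cnj z) * of_real W"
      unfolding kernel_form_append_left kernel_form_append_right kernel_form_scale_left
        kernel_form_scale_right
      by (simp add: vw VW flip: z_def) (simp add: algebra_simps power2_eq_square)
    also have "\<dots> = of_real (V - 2 * t * (cmod z)\<^sup>2 + t\<^sup>2 * (cmod z)\<^sup>2 * W)"
      by (simp add: zz)
    finally show ?thesis
      using kernel_form_self(2)[OF assms, of ?u] by simp
  qed
  have "(cmod z)\<^sup>2 \<le> V * W"
  proof (cases "W = 0")
    case True
    have "(cmod z)\<^sup>2 = 0"
    proof (rule ccontr)
      assume nz: "(cmod z)\<^sup>2 \<noteq> 0"
      then show False
        \<comment> \<open>With \<open>W = 0\<close> the bound is affine in \<open>t\<close>; at this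
          \<open>t\<close> it equals - V - 2, which is negative.\<close>
        using main[of "(V + 1) / (cmod z)\<^sup>2"] kernel_form_self(2)[OF assms, of v]
        by (simp add: True flip: V_def)
    qed
    then show ?thesis by (simp add: True)
  next
    case False
    then have "W > 0"
      using kernel_form_self(2)[OF assms, of w] by (simp add: W_def)
    then show ?thesis
      \<comment> \<open>The quadratic is smallest at this \<open>t\<close>.\<close>
      using main[of "1 / W"] by (simp add: field_simps power2_eq_square)
  qed
  then show ?thesis
    by (simp add: vw V_def W_def)
qed

lemma positive_kernel_Cauchy_Schwarz:
  assumes "positive_kernel k"
  shows "(cmod (k x y))\<^sup>2 \<le> Re (k x x) * Re (k y y)"
  using kernel_form_Cauchy_Schwarz[OF assms, of "[(1, x)]" "[(1, y)]"]
  by (simp add: kernel_form_singleton)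

section \<open>Rank-one kernels and pointwise products\<close>

lemma kernel_form_one:
  "kernel_form (\<lambda>_ _. 1) v w = cnj (\<Sum>(c, x)\<leftarrow>v. c) * (\<Sum>(c, x)\<leftarrow>w. c)"
  by (induction v)
    (simp_all add: kernel_form_def case_prod_unfold distrib_right sum_list_const_mult)

lemma positive_kernel_one: "positive_kernel (\<lambda>_ _. 1)"
  by (simp add: positive_kernel_def kernel_form_one less_eq_complex_def)

text \<open>The Schur complement at \<open>x\<close>: the inner product of the components orthogonal
  to \<open>x\<close>. Its positivity is Cauchy-Schwarz against \<open>x\<close>. If
  \<open>k x x = 0\<close>, division by zero makes the subtracted term vanish.\<close>

lemma positive_kernel_reduce:
  assumes "positive_kernel k"
  shows "positive_kernel (\<lambda>y z. k y z - k y x * k x z / k x x)"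
proof -
  have "0 \<le> kernel_form (\<lambda>y z. k y z - k y x * k x z / k x x) v v" for v
  proof -
    let ?s = "kernel_form k [(1, x)] v"
    have s: "?s = (\<Sum>(d, y)\<leftarrow>v. d * k x y)"
      by (simp add: kernel_form_def)
    \<comment> \<open>By symmetry the subtracted kernel is the constant kernel 1 twisted by
      \<open>k x\<close>, hence of rank one.\<close>
    have r: "kernel_form (\<lambda>y z. k y x * k x z) v v = cnj ?s * ?s"
      using kernel_form_twist[of "k x" "\<lambda>_ _. 1" v v]
      by (simp add: s kernel_form_one case_prod_unfold o_def mult.commute
          flip: positive_kernel_sym[OF assms])
    have "kernel_form (\<lambda>y z. k y z - k y x * k x z / k x x) v v
        = kernel_form k v v + (- 1 / k x x) * kernel_form (\<lambda>y z. k y x * k x z) v v"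
      by (simp flip: kernel_form_add kernel_form_cmult)
    also have "\<dots> = of_real (Re (kernel_form k v v) - (cmod ?s)\<^sup>2 / Re (k x x))"
      unfolding r s[symmetric]
      using complex_norm_square[of ?s] kernel_form_self(1)[OF assms, of v]
        positive_kernel_diag(1)[OF assms, of x]
      by (simp add: mult_ac)
    also have "\<dots> \<ge> 0"
    proof -
      have "(cmod ?s)\<^sup>2 \<le> Re (k x x) * Re (kernel_form k v v)"
        using kernel_form_Cauchy_Schwarz[OF assms, of "[(1, x)]" v]
        by (simp add: kernel_form_singleton)
      then have "(cmod ?s)\<^sup>2 / Re (k x x) \<le> Re (kernel_form k v v)"
        using positive_kernel_diag(2)[OF assms, of x] kernel_form_self(2)[OF assms, of v]
        by (cases "Re (k x x) = 0") (auto simp: field_simps)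
      then show ?thesis
        by (simp only: less_eq_complex_def Re_complex_of_real Im_complex_of_real zero_complex.sel) simp
    qed
    finally show ?thesis .
  qed
  then show ?thesis by (simp add: positive_kernel_def)
qed

text \<open>The Schur product theorem: by Gaussian elimination the first factor becomes a sum of
  rank-one kernels, and multiplying by a rank-one kernel only rescales the points of the second.\<close>

lemma positive_kernel_mult:
  assumes "positive_kernel k" "positive_kernel l"
  shows "positive_kernel (\<lambda>x y. k x y * l x y)"
proof -
  have "0 \<le> kernel_form (\<lambda>x y. k x y * l x y) v v" for v
    using assms(1)
  proof (induction v arbitrary: k)
    case (Cons p v)
    obtain c x where p: "p = (c, x)" by (cases p)
    define k' where "k' = (\<lambda>y z. k y z - k y x * k x z / k x x)"
    have k': "positive_kernel k'"
      unfolding k'_def by (rule positive_kernel_reduce[OF Cons.prems])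
    \<comment> \<open>Elimination clears the row and column of the pivot \<open>x\<close>. For a
      zero pivot they were already zero, by Cauchy-Schwarz.\<close>
    have zero: "k' x y = 0" "k' y x = 0" for y
    proof -
      show "k' x y = 0" for y
        using positive_kernel_Cauchy_Schwarz[OF Cons.prems, of x y]
        by (cases "k x x = 0") (auto simp: k'_def)
      then show "k' y x = 0"
        using positive_kernel_sym[OF k', of y x] by simp
    qed
    let ?w = "map (\<lambda>(d, y). (k x y * d, y)) (p # v)"
    have "kernel_form (\<lambda>y z. k y z * l y z) (p # v) (p # v)
        = kernel_form (\<lambda>y z. k' y z * l y z + (1 / k x x) * (cnj (k x y) * k x z * l y z)) (p # v) (p # v)"
      by (rule arg_cong[where f = "\<lambda>k. kernel_form k (p # v) (p # v)"])
        (simp add: fun_eq_iff k'_def algebra_simps flip: positive_kernel_sym[OF Cons.prems, of _ x])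
    also have "\<dots> = kernel_form (\<lambda>y z. k' y z * l y z) (p # v) (p # v)
        + (1 / k x x) * kernel_form l ?w ?w"
      unfolding kernel_form_add kernel_form_cmult kernel_form_twist ..
    \<comment> \<open>All terms involving the head of the list vanish, so the induction hypothesis
      applies to the tail with \<open>k'\<close> in place of \<open>k\<close>.\<close>
    also have "kernel_form (\<lambda>y z. k' y z * l y z) (p # v) (p # v)
        = kernel_form (\<lambda>y z. k' y z * l y z) v v"
      by (simp add: kernel_form_def p zero case_prod_unfold)
    also have "0 \<le> \<dots> + (1 / k x x) * kernel_form l ?w ?w"
    proof (intro add_nonneg_nonneg Cons.IH k')
      have "(1 / k x x) * kernel_form l ?w ?w = of_real (Re (kernel_form l ?w ?w) / Re (k x x))"
        using kernel_form_self(1)[OF assms(2), of ?w] positive_kernel_diag(1)[OF Cons.prems, of x]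
        by simp
      also have "\<dots> \<ge> 0"
        using kernel_form_self(2)[OF assms(2), of ?w] positive_kernel_diag(2)[OF Cons.prems, of x]
        by (simp only: less_eq_complex_def Re_complex_of_real Im_complex_of_real zero_complex.sel) simp
      finally show "0 \<le> (1 / k x x) * kernel_form l ?w ?w" .
    qed
    finally show ?case .
  qed simp
  then show ?thesis by (simp add: positive_kernel_def)
qed

lemma positive_kernel_prod:
  assumes "\<And>j. j \<in> J \<Longrightarrow> positive_kernel (k j)"
  shows "positive_kernel (\<lambda>x y. \<Prod>j\<in>J. k j x y)"
  using assms
  by (induction J rule: infinite_finite_induct)
    (auto intro: positive_kernel_one positive_kernel_mult)

section \<open>Almost invariant averages\<close>

text \<open>The mean of the vectors \<open>x h\<close> as a formal combination. Since
  \<open>L\<close> may repeat entries, concatenating two lists of equal length yields the midpoint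
  of their means.\<close>

definition uniform_comb :: "('g \<Rightarrow> 's) \<Rightarrow> 'g list \<Rightarrow> (complex \<times> 's) list" where
  "uniform_comb x L = map (\<lambda>h. (1 / of_nat (length L), x h)) L"

lemma kernel_form_uniform_comb:
  "kernel_form k (uniform_comb x L) (uniform_comb y M) =
     (\<Sum>g\<leftarrow>L. \<Sum>h\<leftarrow>M. k (x g) (y h)) / (of_nat (length L) * of_nat (length M))"
  by (simp add: kernel_form_def uniform_comb_def o_def divide_inverse sum_list_const_mult)

lemma kernel_form_point_uniform_comb:
  "kernel_form k [(1, a)] (uniform_comb x L) = (\<Sum>h\<leftarrow>L. k a (x h)) / of_nat (length L)"
  by (simp add: kernel_form_def uniform_comb_def o_def divide_inverse sum_list_const_mult)

text \<open>If the average over \<open>L\<close> has almost minimal norm, then its midpoint with a translate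
  cannot be much shorter, so the parallelogram identity makes the two almost equal.\<close>

lemma almost_invariant_average:
  fixes K :: "'g::group_add set"
  assumes k: "positive_kernel k"
    and K: "subsemigroup K" "K \<noteq> {}"
    and inv: "\<And>g h h'. g \<in> K \<Longrightarrow> h \<in> K \<Longrightarrow> h' \<in> K \<Longrightarrow> k (x (g + h)) (x (g + h')) = k (x h) (x h')"
    and "\<eta> > 0"
  obtains L where "L \<noteq> []" "set L \<subseteq> K"
    "\<And>g a. g \<in> K \<Longrightarrow> (cmod ((\<Sum>h\<leftarrow>L. k a (x (g + h))) / of_nat (length L)
        - (\<Sum>h\<leftarrow>L. k a (x h)) / of_nat (length L)))\<^sup>2 \<le> Re (k a a) * \<eta>"
proof -
  define Q where "Q L = Re (kernel_form k (uniform_comb x L) (uniform_comb x L))" for L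
  define S where "S = {L. L \<noteq> [] \<and> set L \<subseteq> K}"
  obtain h0 where "h0 \<in> K" using K by auto
  then have S: "S \<noteq> {}" by (auto simp: S_def intro!: exI[of _ "[h0]"])
  have bdd: "bdd_below (Q ` S)"
    by (rule bdd_belowI2[of _ 0]) (simp add: Q_def kernel_form_self(2)[OF k])
  \<comment> \<open>The infimum need not be attained. The slack is a quarter of
    \<open>\<eta>\<close> because the parallelogram identity below multiplies it by 4.\<close>
  obtain L where L: "L \<in> S" "Q L < (INF L\<in>S. Q L) + \<eta> / 4"
    using cINF_less_iff[OF S bdd, of "(INF L\<in>S. Q L) + \<eta> / 4"] \<open>\<eta> > 0\<close> by auto
  have close: "(cmod ((\<Sum>h\<leftarrow>L. k a (x (g + h))) / of_nat (length L)
        - (\<Sum>h\<leftarrow>L. k a (x h)) / of_nat (length L)))\<^sup>2 \<le> Re (k a a) * \<eta>" if g: "g \<in> K" for g a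
  proof -
    let ?n = "of_nat (length L) :: complex"
    let ?c = "uniform_comb x L"
    let ?d = "uniform_comb (\<lambda>h. x (g + h)) L"
    let ?M = "map ((+) g) L @ L"
    let ?m = "map (\<lambda>(c, x). (-1 * c, x)) ?c"
    let ?h = "map (\<lambda>(c, x). (1/2 * c, x)) (?d @ ?c)"
    have M: "?M \<in> S"
      using L(1) g K(1) by (auto simp: S_def subsemigroup_def)
    have half: "uniform_comb x ?M = ?h"
      by (simp add: uniform_comb_def)
    \<comment> \<open>Translation by \<open>g\<close> acts isometrically on the orbit, so both means
      have the same norm.\<close>
    have dd: "kernel_form k ?d ?d = kernel_form k ?c ?c"
      unfolding kernel_form_uniform_comb
      using L(1) inv[OF g] by (intro arg_cong2[where f = "(/)"] arg_cong[where f = sum_list] map_cong refl)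
        (auto simp: S_def)
    have "(INF L\<in>S. Q L) \<le> Q ?M"
      by (rule cINF_lower[OF bdd M])
    then have "Q L < Q ?M + \<eta> / 4"
      using L(2) by linarith
    moreover have "kernel_form k (?d @ ?m) (?d @ ?m) = 4 * kernel_form k ?c ?c - 4 * kernel_form k ?h ?h"
      unfolding kernel_form_scale_right kernel_form_scale_left kernel_form_append_left
        kernel_form_append_right
      by (simp add: dd algebra_simps)
    then have "Re (kernel_form k (?d @ ?m) (?d @ ?m)) = 4 * Q L - 4 * Q ?M"
      by (simp add: Q_def half)
    ultimately have small: "Re (kernel_form k (?d @ ?m) (?d @ ?m)) \<le> \<eta>"
      by linarith
    \<comment> \<open>The difference of the two means is small in norm, hence small against every
      \<open>a\<close>; thus one \<open>L\<close> serves all \<open>g\<close> and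
      \<open>a\<close>.\<close>
    have "(cmod (kernel_form k [(1, a)] (?d @ ?m)))\<^sup>2
        \<le> Re (k a a) * Re (kernel_form k (?d @ ?m) (?d @ ?m))"
      using kernel_form_Cauchy_Schwarz[OF k, of "[(1, a)]" "?d @ ?m"]
      by (simp add: kernel_form_singleton)
    also have "\<dots> \<le> Re (k a a) * \<eta>"
      by (rule mult_left_mono[OF small positive_kernel_diag(2)[OF k]])
    finally show ?thesis
      unfolding kernel_form_append_right kernel_form_scale_right kernel_form_point_uniform_comb
      by simp
  qed
  show thesis
    using L(1) close by (intro that[of L]) (auto simp: S_def)
qed

lemma norm_sum_list_diff_le:
  fixes f :: "'b \<Rightarrow> 'c::real_normed_algebra_1"
  assumes "\<And>h. h \<in> set L \<Longrightarrow> norm (f h - z) \<le> D"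
  shows "norm ((\<Sum>h\<leftarrow>L. f h) - of_nat (length L) * z) \<le> real (length L) * D"
  using assms
proof (induction L)
  case (Cons h L)
  have "norm ((f h - z) + ((\<Sum>h\<leftarrow>L. f h) - of_nat (length L) * z)) \<le> D + real (length L) * D"
    using Cons by (intro norm_triangle_mono) auto
  then show ?case by (simp add: algebra_simps)
qed simp

text \<open>The average over \<open>L\<close> stands for the projection of \<open>a\<close> onto the invariant vectors; its norm
  is at least that of its component along the invariant unit vector \<open>e\<close>.\<close>

lemma almost_invariant_average_lower_bound:
  fixes K :: "'g::group_add set"
  assumes k: "positive_kernel k"
    and L: "L \<noteq> []" "set L \<subseteq> K" and D: "0 \<le> D" "Re (k a a) * \<eta> \<le> D\<^sup>2"
    and close: "\<And>g a. g \<in> K \<Longrightarrow> (cmod ((\<Sum>h\<leftarrow>L. k a (x (g + h))) / of_nat (length L)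
        - (\<Sum>h\<leftarrow>L. k a (x h)) / of_nat (length L)))\<^sup>2 \<le> Re (k a a) * \<eta>"
    and diag: "\<And>h. h \<in> K \<Longrightarrow> k (x h) (x h) = k a a"
    and shift: "\<And>h h'. h \<in> K \<Longrightarrow> h' \<in> K \<Longrightarrow> k (x h) (x (h + h')) = k a (x h')"
    and e: "k e e = 1" "\<And>h. h \<in> K \<Longrightarrow> k e (x h) = p"
  shows "(cmod p)\<^sup>2 - D \<le> cmod ((\<Sum>h\<leftarrow>L. k a (x h)) / of_nat (length L))"
proof -
  let ?n = "of_nat (length L) :: complex"
  let ?c = "uniform_comb x L"
  define z where "z = (\<Sum>h\<leftarrow>L. k a (x h)) / ?n"
  have n: "?n \<noteq> 0" using L(1) by simp
  \<comment> \<open>Almost invariance is tested against the orbit point \<open>x h\<close>: by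
    \<open>shift\<close>, the mean translated by \<open>h\<close> pairs with \<open>x h\<close> to
    exactly \<open>z\<close>. Averaging over \<open>h\<close> then compares the squared norm of the
    mean with \<open>z\<close>.\<close>
  have "cmod ((\<Sum>h'\<leftarrow>L. k (x h) (x h')) / ?n - z) \<le> D" if "h \<in> set L" for h
  proof -
    have h: "h \<in> K" using that L(2) by auto
    have "(\<Sum>h'\<leftarrow>L. k (x h) (x (h + h'))) = (\<Sum>h'\<leftarrow>L. k a (x h'))"
      using L(2) by (intro arg_cong[where f = sum_list] map_cong refl shift[OF h]) auto
    then have "(cmod (z - (\<Sum>h'\<leftarrow>L. k (x h) (x h')) / ?n))\<^sup>2 \<le> D\<^sup>2"
      using close[OF h, of "x h"] D(2) by (simp add: diag[OF h] z_def)
    then show ?thesis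
      using D(1) by (simp add: norm_minus_commute power2_le_iff_abs_le)
  qed
  then have "cmod ((\<Sum>h\<leftarrow>L. (\<Sum>h'\<leftarrow>L. k (x h) (x h')) / ?n) - ?n * z) \<le> real (length L) * D"
    by (rule norm_sum_list_diff_le)
  moreover have "(\<Sum>h\<leftarrow>L. (\<Sum>h'\<leftarrow>L. k (x h) (x h')) / ?n) - ?n * z = ?n * (kernel_form k ?c ?c - z)"
    using n by (simp add: kernel_form_uniform_comb divide_inverse sum_list_const_mult sum_list_mult_const
        algebra_simps)
  ultimately have "cmod (kernel_form k ?c ?c - z) \<le> D"
    using L(1) by (simp add: norm_mult)
  \<comment> \<open>\<open>p\<close> is the inner product of the unit vector \<open>e\<close> with
    the mean, so Cauchy-Schwarz applies.\<close>
  moreover have "(cmod p)\<^sup>2 \<le> Re (kernel_form k ?c ?c)"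
  proof -
    have "(\<Sum>h\<leftarrow>L. k e (x h)) = (\<Sum>h\<leftarrow>L. p)"
      using L(2) e(2) by (intro arg_cong[where f = sum_list] map_cong refl) auto
    then have "kernel_form k [(1, e)] ?c = p"
      using n by (simp add: kernel_form_point_uniform_comb sum_list_triv)
    then show ?thesis
      using kernel_form_Cauchy_Schwarz[OF k, of "[(1, e)]" ?c]
      by (simp add: kernel_form_singleton e(1))
  qed
  ultimately show ?thesis
    using complex_Re_le_cmod[of "kernel_form k ?c ?c"] norm_triangle_sub[of "kernel_form k ?c ?c" z]
    unfolding z_def by linarith
qed

section \<open>Integrals over translates\<close>

lemma norm_integral_le_integral:
  fixes f :: "'b \<Rightarrow> 'c::{banach, second_countable_topology}"
  assumes "integrable M f" "integrable M g" "\<And>x. norm (f x) \<le> g x"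
  shows "norm (integral\<^sup>L M f) \<le> integral\<^sup>L M g"
  using assms
  by (intro order_trans[OF integral_norm_bound Bochner_Integration.integral_mono]) auto

abbreviation (input) translate :: "'g::group_add \<Rightarrow> 'g set \<Rightarrow> 'g set" where
  "translate h E \<equiv> (\<lambda>k. k + h) ` E"

lemma measurable_translate:
  fixes h :: "'g::{topological_group_add, t2_space}"
  shows "(\<lambda>k. k + h) \<in> borel_measurable borel"
  by (intro borel_measurable_continuous_onI continuous_intros)

text \<open>Turns preimages under the continuous right translations into translates, which gives
  measurability of translates and the push-forward of the Haar measure.\<close>

lemma vimage_translate: "(\<lambda>k. k + h) -` E = translate (- h) E" for h :: "'g::group_add"
proof (intro set_eqI iffI)
  show "k \<in> translate (- h) E" if "k \<in> (\<lambda>k. k + h) -` E" for k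
    using that by (intro image_eqI[of _ _ "k + h"]) (auto simp: add.assoc)
qed (auto simp: add.assoc)

lemma borel_translate:
  fixes h :: "'g::{topological_group_add, t2_space}"
  assumes "E \<in> sets borel"
  shows "translate h E \<in> sets borel"
  using measurable_sets[OF measurable_translate[of "- h"] assms]
  by (simp only: vimage_translate space_borel Int_UNIV_right minus_minus)

lemma emeasure_translate:
  assumes "right_haar_measure \<mu>" "E \<in> sets borel"
  shows "emeasure \<mu> (translate h E) = emeasure \<mu> E"
  using assms unfolding right_haar_measure_def by blast

lemma measure_translate:
  assumes "right_haar_measure \<mu>" "E \<in> sets borel"
  shows "measure \<mu> (translate h E) = measure \<mu> E"
  using emeasure_translate[OF assms] by (simp add: measure_def)

lemma distr_translate:
  assumes "right_haar_measure \<mu>"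
  shows "distr \<mu> borel (\<lambda>k. k + h) = \<mu>"
proof (rule measure_eqI)
  have sets: "sets \<mu> = sets borel"
    using assms by (simp add: right_haar_measure_def)
  then have "space \<mu> = UNIV"
    using sets_eq_imp_space_eq[OF sets] by simp
  moreover have "(\<lambda>k. k + h) \<in> measurable \<mu> borel"
    using measurable_translate measurable_cong_sets[OF sets refl] by blast
  ultimately show "emeasure (distr \<mu> borel (\<lambda>k. k + h)) E = emeasure \<mu> E"
    if "E \<in> sets (distr \<mu> borel (\<lambda>k. k + h))" for E
    using that
    by (simp only: emeasure_distr sets_distr vimage_translate Int_UNIV_right
        emeasure_translate[OF assms])
qed (use assms in \<open>simp add: right_haar_measure_def\<close>)

section \<open>Averages of a bounded function on a commutative semigroup\<close>

locale bounded_on_commutative_semigroup =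
  fixes \<mu> :: "'g::{topological_group_add, t2_space} measure"
    and K :: "'g set" and f :: "'g \<Rightarrow> complex" and M :: real
  assumes haar: "right_haar_measure \<mu>"
    and semigroup: "subsemigroup K"
    and borel_domain: "K \<in> sets borel"
    and commute: "g \<in> K \<Longrightarrow> h \<in> K \<Longrightarrow> g + h = h + g"
    and measurable_f: "f \<in> borel_measurable (restrict_space borel K)"
    and bounded_f: "g \<in> K \<Longrightarrow> cmod (f g) \<le> M"
begin

lemma sets_haar [simp]: "sets \<mu> = sets borel"
  using haar by (simp add: right_haar_measure_def)

lemma space_haar [simp]: "space \<mu> = UNIV"
  using sets_eq_imp_space_eq[OF sets_haar] by simp

text \<open>The values of \<open>f\<close> off \<open>K\<close> are arbitrary, so measurability on
  the whole group holds only after a cut-off inside \<open>K\<close>.\<close>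

lemma indicator_measurable:
  assumes "E \<in> sets borel" "E \<subseteq> K"
  shows "(\<lambda>k. indicator E k *\<^sub>R f k) \<in> borel_measurable borel"
proof -
  have "(\<lambda>k. indicator K k *\<^sub>R f k) \<in> borel_measurable borel"
    using measurable_f borel_domain by (subst (asm) borel_measurable_restrict_space_iff) auto
  then have "(\<lambda>k. indicator E k *\<^sub>R (indicator K k *\<^sub>R f k)) \<in> borel_measurable borel"
    using assms(1) by measurable
  also have "(\<lambda>k. indicator E k *\<^sub>R (indicator K k *\<^sub>R f k)) = (\<lambda>k. indicator E k *\<^sub>R f k)"
    using assms(2) by (auto simp: indicator_def fun_eq_iff)
  finally show ?thesis .
qed

lemma integrable_f:
  assumes "E \<in> sets borel" "E \<subseteq> K" "emeasure \<mu> E < \<infinity>"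
  shows "set_integrable \<mu> E f"
  unfolding set_integrable_def
proof (rule integrableI_bounded_set[where A = E and B = M])
  show "(\<lambda>k. indicator E k *\<^sub>R f k) \<in> borel_measurable \<mu>"
    using indicator_measurable[OF assms(1,2)] measurable_cong_sets[OF sets_haar refl] by blast
  show "AE k in \<mu>. k \<in> E \<longrightarrow> norm (indicator E k *\<^sub>R f k) \<le> M"
    using assms(2) bounded_f by (intro always_eventually) auto
qed (use assms in auto)

lemma translate_subset: "E \<subseteq> K \<Longrightarrow> h \<in> K \<Longrightarrow> translate h E \<subseteq> K"
  using semigroup by (auto simp: subsemigroup_def)

text \<open>Makes the results of this locale available for shifted functions, with the same bound
  \<open>M\<close>.\<close>

lemma shifted:
  assumes "h \<in> K"
  shows "bounded_on_commutative_semigroup \<mu> K (\<lambda>g. f (g + h)) M"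
proof
  have "(\<lambda>g. g + h) \<in> measurable (restrict_space borel K) (restrict_space borel K)"
    using translate_subset[OF order_refl assms]
    by (intro measurable_restrict_space2 measurable_restrict_space1 measurable_translate)
      (auto simp: space_restrict_space)
  from measurable_compose[OF this measurable_f]
  show "(\<lambda>g. f (g + h)) \<in> borel_measurable (restrict_space borel K)" .
  show "cmod (f (g + h)) \<le> M" if "g \<in> K" for g
    using translate_subset[OF order_refl assms] that by (intro bounded_f) auto
qed (use haar semigroup borel_domain commute in auto)

lemma integral_translate:
  assumes "E \<in> sets borel" "E \<subseteq> K" "h \<in> K"
  shows "(LINT g:translate h E|\<mu>. f g) = (LINT g:E|\<mu>. f (g + h))"
proof -
  let ?F = "\<lambda>g. indicator (translate h E) g *\<^sub>R f g"
  have "(LINT g:translate h E|\<mu>. f g) = integral\<^sup>L (distr \<mu> borel (\<lambda>k. k + h)) ?F"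
    by (simp add: set_lebesgue_integral_def distr_translate[OF haar])
  also have "\<dots> = (LINT g|\<mu>. ?F (g + h))"
    using indicator_measurable[OF borel_translate[OF assms(1), of h] translate_subset[OF assms(2,3)]]
      measurable_translate[of h] measurable_cong_sets[OF sets_haar refl]
    by (intro integral_distr) auto
  also have "\<dots> = (LINT g:E|\<mu>. f (g + h))"
    unfolding set_lebesgue_integral_def
    by (rule Bochner_Integration.integral_cong) (auto simp: indicator_def)
  finally show ?thesis .
qed

text \<open>The two cut-off integrands agree off the symmetric difference and differ there by at
  most \<open>M\<close>.\<close>

lemma integral_diff_le:
  assumes E: "E \<in> sets borel" "E \<subseteq> K" "emeasure \<mu> E < \<infinity>"
    and F: "F \<in> sets borel" "F \<subseteq> K" "emeasure \<mu> F < \<infinity>"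
  shows "cmod ((LINT g:E|\<mu>. f g) - (LINT g:F|\<mu>. f g)) \<le> M * measure \<mu> (sym_diff E F)"
proof -
  let ?S = "sym_diff E F"
  have "emeasure \<mu> ?S \<le> emeasure \<mu> (E \<union> F)"
    using E F by (intro emeasure_mono) auto
  also have "\<dots> \<le> emeasure \<mu> E + emeasure \<mu> F"
    using E F by (intro emeasure_subadditive) auto
  also have "\<dots> < \<infinity>"
    using E F by simp
  finally have S: "emeasure \<mu> ?S < \<infinity>" .
  have "(LINT g:E|\<mu>. f g) - (LINT g:F|\<mu>. f g)
      = (LINT g|\<mu>. indicator E g *\<^sub>R f g - indicator F g *\<^sub>R f g)"
    using integrable_f[OF E] integrable_f[OF F]
    by (simp add: set_lebesgue_integral_def set_integrable_def)
  also have "cmod \<dots> \<le> (LINT g|\<mu>. M * indicator ?S g)"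
  proof (rule norm_integral_le_integral)
    show "integrable \<mu> (\<lambda>g. M * indicator ?S g)"
      using E F S by (intro integrable_mult_right integrable_real_indicator) auto
    show "cmod (indicator E g *\<^sub>R f g - indicator F g *\<^sub>R f g) \<le> M * indicator ?S g" for g
      using E(2) F(2) bounded_f[of g] by (auto simp: indicator_def)
  qed (use integrable_f[OF E] integrable_f[OF F] in \<open>simp add: set_integrable_def\<close>)
  also have "\<dots> = M * measure \<mu> ?S"
    by simp
  finally show ?thesis .
qed

lemma integral_shift_diff_le:
  assumes "E \<in> sets borel" "E \<subseteq> K" "emeasure \<mu> E < \<infinity>" "h \<in> K"
  shows "cmod ((LINT g:E|\<mu>. f g) - (LINT g:E|\<mu>. f (g + h)))
    \<le> M * measure \<mu> (sym_diff E (translate h E))"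
  unfolding integral_translate[OF assms(1,2,4), symmetric]
  using assms
  by (intro integral_diff_le borel_translate translate_subset) (auto simp: emeasure_translate[OF haar])

text \<open>Sums the estimate for a single shift over \<open>L\<close>. Integrability is carried
  through the same induction because splitting the integral uses it.\<close>

lemma integral_list_average:
  assumes "E \<in> sets borel" "E \<subseteq> K" "emeasure \<mu> E < \<infinity>" "set L \<subseteq> K"
  shows "set_integrable \<mu> E (\<lambda>g. \<Sum>h\<leftarrow>L. f (g + h)) \<and>
    cmod (of_nat (length L) * (LINT g:E|\<mu>. f g) - (LINT g:E|\<mu>. \<Sum>h\<leftarrow>L. f (g + h)))
      \<le> M * (\<Sum>h\<leftarrow>L. measure \<mu> (sym_diff E (translate h E)))"
  using assms(4)
proof (induction L)
  case (Cons h L)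
  then have h: "h \<in> K" by simp
  interpret h: bounded_on_commutative_semigroup \<mu> K "\<lambda>g. f (g + h)" M
    by (rule shifted[OF h])
  note int = h.integrable_f[OF assms(1-3)]
  have L: "set_integrable \<mu> E (\<lambda>g. \<Sum>h\<leftarrow>L. f (g + h))"
    "cmod (of_nat (length L) * (LINT g:E|\<mu>. f g) - (LINT g:E|\<mu>. \<Sum>h\<leftarrow>L. f (g + h)))
      \<le> M * (\<Sum>h\<leftarrow>L. measure \<mu> (sym_diff E (translate h E)))"
    using Cons by auto
  have "of_nat (length (h # L)) * (LINT g:E|\<mu>. f g) - (LINT g:E|\<mu>. \<Sum>h\<leftarrow>h # L. f (g + h))
    = ((LINT g:E|\<mu>. f g) - (LINT g:E|\<mu>. f (g + h)))
      + (of_nat (length L) * (LINT g:E|\<mu>. f g) - (LINT g:E|\<mu>. \<Sum>h\<leftarrow>L. f (g + h)))"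
    using L(1) int by (simp add: set_integral_add algebra_simps)
  also have "cmod \<dots> \<le> M * measure \<mu> (sym_diff E (translate h E))
      + M * (\<Sum>h\<leftarrow>L. measure \<mu> (sym_diff E (translate h E)))"
    by (rule norm_triangle_mono[OF integral_shift_diff_le[OF assms(1-3) h] L(2)])
  finally show ?case
    using set_integral_add(1)[OF int L(1)] by (simp add: distrib_left)
qed (auto simp: set_integrable_def set_lebesgue_integral_def)

text \<open>Replacing \<open>f\<close> by its mean over the shifts in \<open>L\<close> costs only
  the boundary terms of \<open>E\<close>, and that mean is pointwise within \<open>D\<close> of
  \<open>z\<close>.\<close>

lemma average_close:
  assumes E: "E \<in> sets borel" "E \<subseteq> K" "emeasure \<mu> E < \<infinity>" "0 < measure \<mu> E"
    and L: "L \<noteq> []" "set L \<subseteq> K"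
    and close: "\<And>g. g \<in> K \<Longrightarrow> cmod ((\<Sum>h\<leftarrow>L. f (g + h)) / of_nat (length L) - z) \<le> D"
  shows "cmod ((1 / measure \<mu> E) *\<^sub>R (LINT g:E|\<mu>. f g) - z)
    \<le> D + M * (\<Sum>h\<leftarrow>L. measure \<mu> (sym_diff E (translate h E)) / measure \<mu> E)"
proof -
  define n where "n = real (length L)"
  have n: "1 \<le> n" using L(1) by (cases L) (auto simp: n_def)
  define m where "m = measure \<mu> E"
  have m: "0 < m" using E(4) by (simp add: m_def)
  define I where "I = (LINT g:E|\<mu>. f g)"
  define J where "J = (LINT g:E|\<mu>. \<Sum>h\<leftarrow>L. f (g + h))"
  define S where "S = (\<Sum>h\<leftarrow>L. measure \<mu> (sym_diff E (translate h E)))"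
  have "0 \<le> S" unfolding S_def by (rule sum_list_nonneg) auto
  obtain e where "e \<in> E" using E(4) by (cases "E = {}") auto
  then have M: "0 \<le> M" using order_trans[OF norm_ge_zero bounded_f[of e]] E(2) by auto
  have 1: "cmod (of_real n * I - J) \<le> M * S"
    using integral_list_average[OF E(1-3) L(2), THEN conjunct2] by (simp add: n_def I_def J_def S_def)
  have const: "set_integrable \<mu> E (\<lambda>_. c)" "(LINT g:E|\<mu>. c) = m *\<^sub>R c"
    for c :: "'b::{banach, second_countable_topology}"
    using E by (auto simp: set_integrable_def set_lebesgue_integral_def m_def)
  have "J - of_real (m * n) * z = (LINT g:E|\<mu>. (\<Sum>h\<leftarrow>L. f (g + h)) - of_real n * z)"
    using integral_list_average[OF E(1-3) L(2), THEN conjunct1]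
    by (simp add: J_def const scaleR_conv_of_real mult.assoc)
  also have "cmod \<dots> \<le> (LINT g:E|\<mu>. n * D)"
    unfolding set_lebesgue_integral_def
  proof (rule norm_integral_le_integral)
    show "integrable \<mu> (\<lambda>g. indicator E g *\<^sub>R ((\<Sum>h\<leftarrow>L. f (g + h)) - of_real n * z))"
      using set_integral_diff(1)[OF integral_list_average[OF E(1-3) L(2), THEN conjunct1] const(1)]
      by (simp add: set_integrable_def)
    show "integrable \<mu> (\<lambda>g. indicator E g *\<^sub>R (n * D))"
      using const(1)[of "n * D"] by (simp add: set_integrable_def)
    fix g
    show "cmod (indicator E g *\<^sub>R ((\<Sum>h\<leftarrow>L. f (g + h)) - of_real n * z)) \<le> indicator E g *\<^sub>R (n * D)"
    proof (cases "g \<in> E")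
      case True
      then have "n * cmod ((\<Sum>h\<leftarrow>L. f (g + h)) / of_real n - z) \<le> n * D"
        using close[of g] E(2) n by (intro mult_left_mono) (auto simp: n_def)
      also have "n * cmod ((\<Sum>h\<leftarrow>L. f (g + h)) / of_real n - z)
          = cmod (of_real n * ((\<Sum>h\<leftarrow>L. f (g + h)) / of_real n - z))"
        using n by (simp add: norm_mult)
      also have "\<dots> = cmod ((\<Sum>h\<leftarrow>L. f (g + h)) - of_real n * z)"
        using n by (simp add: right_diff_distrib)
      finally show ?thesis using True by simp
    qed simp
  qed
  also have "\<dots> = m * n * D"
    by (simp add: const(2))
  finally have 2: "cmod (J - of_real (m * n) * z) \<le> m * n * D" .
  have "of_real (m * n) * ((1 / m) *\<^sub>R I - z) = (of_real n * I - J) + (J - of_real (m * n) * z)"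
    using m by (simp add: scaleR_conv_of_real algebra_simps)
  then have "m * n * cmod ((1 / m) *\<^sub>R I - z) = cmod ((of_real n * I - J) + (J - of_real (m * n) * z))"
    using m n by (metis abs_of_nonneg mult_nonneg_nonneg norm_mult norm_of_real less_imp_le
        order_trans zero_le_one)
  also have "\<dots> \<le> M * S + m * n * D"
    by (rule norm_triangle_mono[OF 1 2])
  \<comment> \<open>A crude bound: the factor 1/n is given up, since the boundary terms tend to zero
    for fixed \<open>L\<close> anyway.\<close>
  also have "\<dots> \<le> n * (M * S) + m * n * D"
    using mult_right_mono[OF n, of "M * S"] M \<open>0 \<le> S\<close> by simp
  also have "\<dots> = m * n * (D + M * (S / m))"
    using m by (simp add: field_simps)
  finally have "cmod ((1 / m) *\<^sub>R I - z) \<le> D + M * (S / m)"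
    using m n by simp
  then show ?thesis
    by (simp add: m_def I_def S_def divide_inverse sum_list_mult_const)
qed

text \<open>Commutativity enters here: translations by \<open>h\<close> and \<open>t\<close>
  commute, so the symmetric difference is itself translated by \<open>t\<close>, and right
  invariance applies.\<close>

lemma sym_diff_translate:
  assumes "E \<in> sets borel" "E \<subseteq> K" "h \<in> K" "t \<in> K"
  shows "measure \<mu> (sym_diff (translate t E) (translate h (translate t E)))
    = measure \<mu> (sym_diff E (translate h E))"
proof -
  have "translate h (translate t E) = translate t (translate h E)"
    using commute[OF assms(3,4)] by (simp add: image_image add.assoc)
  then have "sym_diff (translate t E) (translate h (translate t E))
      = translate t (sym_diff E (translate h E))"
    by (simp add: image_Un image_set_diff)
  moreover have "sym_diff E (translate h E) \<in> sets borel"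
    using assms(1) borel_translate[OF assms(1)] by auto
  ultimately show ?thesis
    by (simp only: measure_translate[OF haar])
qed

section \<open>Limits of averages, uniform in the translate\<close>

text \<open>The boundary error is the same for all translates of \<open>\<Lambda> \<alpha>\<close>,
  so one index serves them all. The set \<open>\<Lambda> \<alpha>\<close> is inserted separately
  because \<open>K\<close> may lack a neutral element.\<close>

lemma translate_averages_eventually_close:
  fixes \<Lambda> :: "'i::directed_preorder \<Rightarrow> 'g set"
  assumes \<Lambda>: "space_filling \<mu> K \<Lambda>"
    and L: "L \<noteq> []" "set L \<subseteq> K"
    and close: "\<And>g. g \<in> K \<Longrightarrow> cmod ((\<Sum>h\<leftarrow>L. f (g + h)) / of_nat (length L) - z) \<le> D"
    and "D < \<epsilon>"
  shows "\<forall>\<^sub>F \<alpha> in net_filter. 0 < emeasure \<mu> (\<Lambda> \<alpha>) \<and>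
    (\<forall>E\<in>insert (\<Lambda> \<alpha>) ((\<lambda>t. translate t (\<Lambda> \<alpha>)) ` K).
      cmod ((1 / measure \<mu> (\<Lambda> \<alpha>)) *\<^sub>R (LINT g:E|\<mu>. f g) - z) < \<epsilon>)"
proof -
  define R where "R \<alpha> = (\<Sum>h\<leftarrow>L. measure \<mu> (sym_diff (\<Lambda> \<alpha>) (translate h (\<Lambda> \<alpha>))) / measure \<mu> (\<Lambda> \<alpha>))"
    for \<alpha>
  have "(R \<longlongrightarrow> 0) net_filter"
    unfolding R_def using L(2)
  proof (induction L)
    case (Cons h L)
    then have "((\<lambda>\<alpha>. measure \<mu> (sym_diff (\<Lambda> \<alpha>) (translate h (\<Lambda> \<alpha>))) / measure \<mu> (\<Lambda> \<alpha>)) \<longlongrightarrow> 0) net_filter"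
      using \<Lambda> by (simp add: space_filling_def)
    from tendsto_add[OF this Cons.IH] Cons.prems show ?case by simp
  qed simp
  then have "((\<lambda>\<alpha>. D + M * R \<alpha>) \<longlongrightarrow> D) net_filter"
    by (auto intro!: tendsto_eq_intros)
  then have "\<forall>\<^sub>F \<alpha> in net_filter. D + M * R \<alpha> < \<epsilon>"
    using \<open>D < \<epsilon>\<close> by (rule order_tendstoD)
  moreover have "\<forall>\<^sub>F \<alpha> in net_filter. 0 < emeasure \<mu> (\<Lambda> \<alpha>)"
    using \<Lambda> by (simp add: space_filling_def)
  ultimately show ?thesis
  proof (eventually_elim, intro conjI ballI)
    fix \<alpha> E
    assume small: "D + M * R \<alpha> < \<epsilon>" and pos: "0 < emeasure \<mu> (\<Lambda> \<alpha>)"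
      and E: "E \<in> insert (\<Lambda> \<alpha>) ((\<lambda>t. translate t (\<Lambda> \<alpha>)) ` K)"
    have \<Lambda>\<alpha>: "\<Lambda> \<alpha> \<in> sets borel" "\<Lambda> \<alpha> \<subseteq> K" "emeasure \<mu> (\<Lambda> \<alpha>) < \<infinity>"
      using \<Lambda> by (auto simp: space_filling_def)
    have "0 < measure \<mu> (\<Lambda> \<alpha>)"
      using pos \<Lambda>\<alpha>(3) by (simp add: measure_def enn2real_positive_iff)
    moreover have EK: "E \<in> sets borel" "E \<subseteq> K" "emeasure \<mu> E < \<infinity>"
      using E \<Lambda>\<alpha> translate_subset[OF \<Lambda>\<alpha>(2)]
      by (auto simp: borel_translate emeasure_translate[OF haar])
    moreover have m: "measure \<mu> E = measure \<mu> (\<Lambda> \<alpha>)"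
      using E \<Lambda>\<alpha> by (auto simp: measure_translate[OF haar])
    moreover have "(\<Sum>h\<leftarrow>L. measure \<mu> (sym_diff E (translate h E)) / measure \<mu> E) = R \<alpha>"
      unfolding R_def m
      using E L(2) sym_diff_translate[OF \<Lambda>\<alpha>(1,2)]
      by (intro arg_cong[where f = sum_list] map_cong refl) auto
    ultimately show "cmod ((1 / measure \<mu> (\<Lambda> \<alpha>)) *\<^sub>R (LINT g:E|\<mu>. f g) - z) < \<epsilon>"
      using average_close[OF EK _ L close] small by simp
  qed
qed

text \<open>Each precision has its own \<open>L\<close> and \<open>z\<close>. Eventual closeness to
  some \<open>z\<close> makes the net of averages Cauchy; its limit is close to each such
  \<open>z\<close>, which transfers the lower bound and the uniformity over translates.\<close>

lemma uniform_limit_of_averages: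
  fixes \<Lambda> :: "'i::directed_preorder \<Rightarrow> 'g set"
  assumes \<Lambda>: "space_filling \<mu> K \<Lambda>"
    and approx: "\<And>D. D > 0 \<Longrightarrow> \<exists>L z. L \<noteq> [] \<and> set L \<subseteq> K \<and> c - D \<le> cmod z \<and>
      (\<forall>g\<in>K. cmod ((\<Sum>h\<leftarrow>L. f (g + h)) / of_nat (length L) - z) \<le> D)"
  obtains l where
    "((\<lambda>\<alpha>. (1 / measure \<mu> (\<Lambda> \<alpha>)) *\<^sub>R (LINT g:\<Lambda> \<alpha>|\<mu>. f g)) \<longlongrightarrow> l) net_filter"
    "c \<le> cmod l"
    "\<And>\<epsilon>. \<epsilon> > 0 \<Longrightarrow> \<forall>\<^sub>F \<alpha> in net_filter. 0 < emeasure \<mu> (\<Lambda> \<alpha>) \<and>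
      (\<forall>h\<in>K. cmod ((1 / measure \<mu> (\<Lambda> \<alpha>)) *\<^sub>R (LINT g:translate h (\<Lambda> \<alpha>)|\<mu>. f g) - l) < \<epsilon>)"
proof -
  define a where "a \<alpha> E = (1 / measure \<mu> (\<Lambda> \<alpha>)) *\<^sub>R (LINT g:E|\<mu>. f g)" for \<alpha> E
  have near: "\<exists>z. c - \<epsilon> \<le> cmod z \<and> (\<forall>\<^sub>F \<alpha> in net_filter. 0 < emeasure \<mu> (\<Lambda> \<alpha>) \<and>
      (\<forall>E\<in>insert (\<Lambda> \<alpha>) ((\<lambda>t. translate t (\<Lambda> \<alpha>)) ` K). cmod (a \<alpha> E - z) < \<epsilon>))"
    if "\<epsilon> > 0" for \<epsilon>
  proof -
    from approx[of "\<epsilon> / 2"] that obtain L z where L: "L \<noteq> []" "set L \<subseteq> K" "c - \<epsilon> / 2 \<le> cmod z"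
      "\<And>g. g \<in> K \<Longrightarrow> cmod ((\<Sum>h\<leftarrow>L. f (g + h)) / of_nat (length L) - z) \<le> \<epsilon> / 2"
      by auto
    show ?thesis
      unfolding a_def
      using translate_averages_eventually_close[OF \<Lambda> L(1,2,4), of \<epsilon>] that L(3)
      by (intro exI[of _ z]) auto
  qed
  have near_net: "\<exists>z. c - \<epsilon> \<le> cmod z \<and> (\<forall>\<^sub>F \<alpha> in net_filter. cmod (a \<alpha> (\<Lambda> \<alpha>) - z) < \<epsilon>)"
    if "\<epsilon> > 0" for \<epsilon>
    using near[OF that] by (blast intro: eventually_mono)
  have "cauchy_filter (filtermap (\<lambda>\<alpha>. a \<alpha> (\<Lambda> \<alpha>)) net_filter)"
    unfolding cauchy_filter_metric_filtermap
  proof (intro allI impI)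
    fix \<epsilon> :: real assume "\<epsilon> > 0"
    then obtain z where z: "\<forall>\<^sub>F \<alpha> in net_filter. cmod (a \<alpha> (\<Lambda> \<alpha>) - z) < \<epsilon> / 2"
      using near_net[of "\<epsilon> / 2"] by auto
    show "\<exists>P. eventually P net_filter \<and>
        (\<forall>\<alpha> \<beta>. P \<alpha> \<and> P \<beta> \<longrightarrow> dist (a \<alpha> (\<Lambda> \<alpha>)) (a \<beta> (\<Lambda> \<beta>)) < \<epsilon>)"
      using z by (intro exI conjI) (auto simp: dist_norm intro: norm_triangle_half_l)
  qed
  then obtain l where l: "((\<lambda>\<alpha>. a \<alpha> (\<Lambda> \<alpha>)) \<longlongrightarrow> l) net_filter"
    using cauchy_filter_complete_converges[OF _ complete_UNIV, of "filtermap (\<lambda>\<alpha>. a \<alpha> (\<Lambda> \<alpha>)) net_filter"]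
    by (auto simp: filterlim_def filtermap_bot_iff net_filter_neq_bot)
  have close: "cmod (l - z) \<le> \<epsilon>"
    if "\<forall>\<^sub>F \<alpha> in net_filter. cmod (a \<alpha> (\<Lambda> \<alpha>) - z) < \<epsilon>" for z \<epsilon>
    by (rule tendsto_upperbound[OF tendsto_norm[OF tendsto_diff[OF l tendsto_const]]
          eventually_mono[OF that] net_filter_neq_bot]) simp
  show thesis
  proof (rule that[OF l[unfolded a_def]])
    show "c \<le> cmod l"
    proof (rule field_le_epsilon)
      fix \<epsilon> :: real assume "\<epsilon> > 0"
      then obtain z where z: "c - \<epsilon> / 2 \<le> cmod z"
        "\<forall>\<^sub>F \<alpha> in net_filter. cmod (a \<alpha> (\<Lambda> \<alpha>) - z) < \<epsilon> / 2"
        using near_net[of "\<epsilon> / 2"] by auto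
      show "c \<le> cmod l + \<epsilon>"
        using z(1) close[OF z(2)] norm_triangle_ineq2[of z l] by (simp add: norm_minus_commute)
    qed
  next
    fix \<epsilon> :: real assume "\<epsilon> > 0"
    from near[OF half_gt_zero[OF this]] obtain z where
      z: "\<forall>\<^sub>F \<alpha> in net_filter. 0 < emeasure \<mu> (\<Lambda> \<alpha>) \<and>
        (\<forall>E\<in>insert (\<Lambda> \<alpha>) ((\<lambda>t. translate t (\<Lambda> \<alpha>)) ` K). cmod (a \<alpha> E - z) < \<epsilon> / 2)"
      by blast
    then have lz: "cmod (l - z) \<le> \<epsilon> / 2"
      by (intro close) (auto elim!: eventually_mono)
    have tri: "cmod (w - l) < \<epsilon>" if "cmod (w - z) < \<epsilon> / 2" for w
      using that lz norm_triangle_ineq4[of "w - z" "l - z"] by simp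
    from z show "\<forall>\<^sub>F \<alpha> in net_filter. 0 < emeasure \<mu> (\<Lambda> \<alpha>) \<and>
      (\<forall>h\<in>K. cmod ((1 / measure \<mu> (\<Lambda> \<alpha>)) *\<^sub>R (LINT g:translate h (\<Lambda> \<alpha>)|\<mu>. f g) - l) < \<epsilon>)"
      by eventually_elim (auto simp flip: a_def intro: tri)
  qed
qed

text \<open>An average of values of modulus at most \<open>c\<close> has modulus at most
  \<open>c\<close>.\<close>

lemma exists_large_value:
  assumes E: "E \<in> sets borel" "E \<subseteq> K" "emeasure \<mu> E < \<infinity>" "0 < measure \<mu> E"
    and large: "c < cmod ((1 / measure \<mu> E) *\<^sub>R (LINT g:E|\<mu>. f g))"
  shows "\<exists>g\<in>E. c < cmod (f g)"
proof (rule ccontr)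
  assume "\<not> ?thesis"
  then have le: "cmod (f g) \<le> c" if "g \<in> E" for g
    using that by force
  have "cmod (LINT g:E|\<mu>. f g) \<le> (LINT g|\<mu>. c * indicator E g)"
    unfolding set_lebesgue_integral_def
  proof (rule norm_integral_le_integral)
    show "integrable \<mu> (\<lambda>g. indicator E g *\<^sub>R f g)"
      using integrable_f[OF E(1-3)] by (simp add: set_integrable_def)
    show "integrable \<mu> (\<lambda>g. c * indicator E g)"
      using E by (intro integrable_mult_right integrable_real_indicator) auto
  qed (auto simp: indicator_def le)
  then show False
    using large E(4) by (simp add: divide_inverse[symmetric] field_simps)
qed

end

section \<open>States and their kernels\<close>

context star_algebra_state
begin

lemma state_add: "\<omega> (X + Y) = \<omega> X + \<omega> Y"
  using linear_state by (simp add: Vector_Spaces.linear_iff)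

lemma state_scale: "\<omega> (scale c X) = c * \<omega> X"
  using linear_state by (simp add: Vector_Spaces.linear_iff)

lemma star_one: "star 1 = 1"
  by (metis mult_1_left mult_1_right star_mult star_star)

text \<open>Formal combinations may be evaluated in the algebra, which reduces positivity of the
  kernel to positivity of the state.\<close>

lemma kernel_form_state:
  "kernel_form (\<lambda>X Y. \<omega> (star X * Y)) v w
    = \<omega> (star (\<Sum>(c, X)\<leftarrow>v. scale c X) * (\<Sum>(d, Y)\<leftarrow>w. scale d Y))"
proof -
  have zero: "star 0 = 0" "\<omega> 0 = 0"
    using star_add[of 0 0] state_add[of 0 0] by simp_all
  have single: "kernel_form (\<lambda>X Y. \<omega> (star X * Y)) [(c, X)] w
      = \<omega> (star (scale c X) * (\<Sum>(d, Y)\<leftarrow>w. scale d Y))" for c X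
  proof (induction w)
    case (Cons p w)
    then show ?case
      by (subst kernel_form_Cons_right)
        (cases p, simp add: kernel_form_singleton distrib_left state_add star_scale
          scale_mult_left scale_mult_right state_scale zero mult_ac)
  qed (simp add: zero)
  show ?thesis
  proof (induction v)
    case (Cons p v)
    then show ?case
      by (subst kernel_form_Cons_left) (cases p, simp add: single star_add distrib_right state_add)
  qed (simp add: zero)
qed

lemma positive_kernel_state: "positive_kernel (\<lambda>X Y. \<omega> (star X * Y))"
  by (simp add: positive_kernel_def kernel_form_state state_nonneg)

end

text \<open>The limit \<open>L\<close> is unique because \<open>net_filter\<close> is proper. A
  single \<open>\<alpha>\<^sub>0\<close> serves both the integral bound and, for
  \<open>A = B\<close>, the recurrence claim.\<close>

theorem theorem4p2:
  fixes scale :: "complex \<Rightarrow> 'a::ring_1 \<Rightarrow> 'a"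
    and star :: "'a \<Rightarrow> 'a"
    and \<omega> :: "'a \<Rightarrow> complex"
    and \<tau> :: "'g::{topological_group_add, t2_space} \<Rightarrow> 'a \<Rightarrow> 'a"
    and K :: "'g set"
    and \<mu> :: "'g measure"
    and q :: nat
    and \<phi> :: "nat \<Rightarrow> 'g \<Rightarrow> 'g"
    and \<Lambda> :: "'i::directed_preorder \<Rightarrow> 'g set"
    and A B :: 'a
  assumes "locally_compact_space (euclidean :: 'g topology)"
    and "right_haar_measure \<mu>"
    and "star_dynamical_system scale star \<omega> \<tau> K"
    and "\<And>g h. g \<in> K \<Longrightarrow> h \<in> K \<Longrightarrow> g + h = h + g"
    and "\<And>C D g. g \<in> K \<Longrightarrow> \<omega> (star (\<tau> g C) * \<tau> g D) = \<omega> (star C * D)"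
    and "q \<ge> 1"
    and "\<And>j. j \<in> {1..q} \<Longrightarrow> \<phi> j \<in> measurable (restrict_space borel K) (restrict_space borel K)"
    and "\<And>j g h. j \<in> {1..q} \<Longrightarrow> g \<in> K \<Longrightarrow> h \<in> K \<Longrightarrow> \<phi> j (g + h) = \<phi> j g + \<phi> j h"
    and "space_filling \<mu> K \<Lambda>"
  shows "\<exists>L :: complex.
    ((\<lambda>\<alpha>. (1 / measure \<mu> (\<Lambda> \<alpha>)) *\<^sub>R
        (LINT g:\<Lambda> \<alpha>|\<mu>. \<Prod>j=1..q. \<omega> (star A * \<tau> (\<phi> j g) B))) \<longlongrightarrow> L) net_filter \<and>
    (\<forall>\<epsilon>::real. \<epsilon> > 0 \<longrightarrow> (\<exists>\<alpha>\<^sub>0. 0 < emeasure \<mu> (\<Lambda> \<alpha>\<^sub>0) \<and>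
      (\<forall>h\<in>K. cmod ((1 / measure \<mu> (\<Lambda> \<alpha>\<^sub>0)) *\<^sub>R
          (LINT g:((\<lambda>k. k + h) ` \<Lambda> \<alpha>\<^sub>0)|\<mu>. \<Prod>j=1..q. \<omega> (star A * \<tau> (\<phi> j g) B)))
        > cmod L - \<epsilon>) \<and>
      (A = B \<longrightarrow> (\<forall>h\<in>K. \<exists>g\<in>(\<lambda>k. k + h) ` \<Lambda> \<alpha>\<^sub>0.
        cmod (\<Prod>j=1..q. \<omega> (star A * \<tau> (\<phi> j g) A)) > cmod (\<omega> A) ^ (2 * q) - \<epsilon>))))"
proof -
  interpret star_dynamical_system scale star \<omega> \<tau> K
    by (rule assms(3))
  note isometric = assms(5) and \<phi>_add = assms(8) and filling = assms(9)
  \<comment> \<open>Functions on indices represent elementary tensors; only the indices from 1 to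
    \<open>q\<close> matter.\<close>
  define k where "k = (\<lambda>u v :: nat \<Rightarrow> 'a. \<Prod>j=1..q. \<omega> (star (u j) * v j))"
  define a where "a = (\<lambda>_ :: nat. A)"
  define x where "x g = (\<lambda>j. \<tau> (\<phi> j g) B)" for g
  have k: "positive_kernel k"
    unfolding k_def
    by (rule positive_kernel_prod) (rule positive_kernel_pullback[OF positive_kernel_state])
  have \<phi>_mem: "\<phi> j g \<in> K" if "j \<in> {1..q}" "g \<in> K" for j g
    using measurable_space[OF assms(7)[OF that(1)], of g] that(2)
    by (simp add: space_restrict_space)
  have x_add: "x (g + h) j = \<tau> (\<phi> j g) (x h j)" if "j \<in> {1..q}" "g \<in> K" "h \<in> K" for j g h
    using tau_comp[OF \<phi>_mem[OF that(1,2)] \<phi>_mem[OF that(1,3)]] \<phi>_add[OF that]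
    by (simp add: x_def fun_eq_iff)
  have inv: "k (x (g + h)) (x (g + h')) = k (x h) (x h')" if "g \<in> K" "h \<in> K" "h' \<in> K" for g h h'
    unfolding k_def using that by (intro prod.cong refl) (simp add: x_add isometric \<phi>_mem)
  have diag: "k (x g) (x g) = k (\<lambda>_. B) (\<lambda>_. B)" if "g \<in> K" for g
    unfolding k_def x_def using that by (intro prod.cong refl) (simp add: isometric \<phi>_mem)
  have f: "(\<Prod>j=1..q. \<omega> (star A * \<tau> (\<phi> j g) B)) = k a (x g)" for g
    by (simp add: k_def a_def x_def)
  \<comment> \<open>The bound is Cauchy-Schwarz: all \<open>x g\<close> have the norm of the tensor
    with every factor \<open>B\<close>.\<close>
  interpret bounded_on_commutative_semigroup \<mu> K "\<lambda>g. k a (x g)"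
    "sqrt (Re (k a a) * Re (k (\<lambda>_. B) (\<lambda>_. B)))"
  proof
    show "(\<lambda>g. k a (x g)) \<in> borel_measurable (restrict_space borel K)"
      unfolding f[symmetric]
      by (intro borel_measurable_prod measurable_compose[OF assms(7) measurable_tau])
    show "cmod (k a (x g)) \<le> sqrt (Re (k a a) * Re (k (\<lambda>_. B) (\<lambda>_. B)))" if "g \<in> K" for g
      using positive_kernel_Cauchy_Schwarz[OF k, of a "x g"] diag[OF that]
      by (intro real_le_rsqrt) simp
  qed (use assms subsemigroup_K borel_K in auto)
  have "\<forall>\<^sub>F \<alpha> in net_filter. 0 < emeasure \<mu> (\<Lambda> \<alpha>)"
    using filling by (simp add: space_filling_def)
  then obtain \<alpha> where "0 < emeasure \<mu> (\<Lambda> \<alpha>)"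
    using eventually_happens'[OF net_filter_neq_bot] by blast
  then have "K \<noteq> {}"
    using filling by (force simp: space_filling_def)
  \<comment> \<open>A lower bound for the modulus of the limit. Only \<open>A = B\<close> calls for
    a nontrivial one; the value 0 lets both cases share one argument.\<close>
  define c where "c = (if A = B then cmod (\<omega> A) ^ (2 * q) else 0)"
  have approx: "\<exists>L z. L \<noteq> [] \<and> set L \<subseteq> K \<and> c - D \<le> cmod z \<and>
      (\<forall>g\<in>K. cmod ((\<Sum>h\<leftarrow>L. k a (x (g + h))) / of_nat (length L) - z) \<le> D)" if "D > 0" for D
  proof -
    \<comment> \<open>The added 1 keeps the denominator positive when
      \<open>k a a = 0\<close>.\<close>
    define \<eta> where "\<eta> = D\<^sup>2 / (Re (k a a) + 1)"
    have kaa: "0 \<le> Re (k a a)" by (rule positive_kernel_diag(2)[OF k])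
    then have \<eta>: "\<eta> > 0" "Re (k a a) * \<eta> \<le> D\<^sup>2"
      using that by (auto simp: \<eta>_def field_simps)
    obtain L where L: "L \<noteq> []" "set L \<subseteq> K"
      and close: "\<And>g a. g \<in> K \<Longrightarrow> (cmod ((\<Sum>h\<leftarrow>L. k a (x (g + h))) / of_nat (length L)
        - (\<Sum>h\<leftarrow>L. k a (x h)) / of_nat (length L)))\<^sup>2 \<le> Re (k a a) * \<eta>"
      using almost_invariant_average[of k K x \<eta>, OF k subsemigroup_K \<open>K \<noteq> {}\<close> inv \<eta>(1)] by blast
    have "c - D \<le> cmod ((\<Sum>h\<leftarrow>L. k a (x h)) / of_nat (length L))"
    proof (cases "A = B")
      case True
      have "(cmod (\<omega> A ^ q))\<^sup>2 - D \<le> cmod ((\<Sum>h\<leftarrow>L. k a (x h)) / of_nat (length L))"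
      proof (rule almost_invariant_average_lower_bound[where k = k and a = a,
            OF k L less_imp_le[OF \<open>D > 0\<close>] \<eta>(2)])
        show "k (x h) (x h) = k a a" if "h \<in> K" for h
          using diag[OF that] True by (simp add: a_def)
        show "k (x h) (x (h + h')) = k a (x h')" if "h \<in> K" "h' \<in> K" for h h'
          unfolding k_def using that True
          by (intro prod.cong refl) (simp add: x_add, simp add: x_def a_def isometric \<phi>_mem)
        \<comment> \<open>The invariant unit vector is the tensor power of the cyclic vector,
          represented by the unit of the algebra.\<close>
        show "k (\<lambda>_. 1) (\<lambda>_. 1) = 1"
          by (simp add: k_def star_one state_one)
        show "k (\<lambda>_. 1) (x h) = \<omega> A ^ q" if h: "h \<in> K" for h
        proof -
          \<comment> \<open>The state is invariant: \<open>isometric\<close> is used with 1 as first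
            argument, which \<open>\<tau>\<close> fixes.\<close>
          have "\<omega> (star 1 * x h j) = \<omega> A" if "j \<in> {1..q}" for j
            using isometric[OF \<phi>_mem[OF that h], of 1 B] tau_one[OF \<phi>_mem[OF that h]] True
            by (simp add: x_def star_one)
          then show ?thesis by (simp add: k_def)
        qed
      qed (erule close)
      then show ?thesis
        using True by (simp add: c_def norm_power power_mult mult.commute flip: power_mult)
    next
      case False
      then show ?thesis
        using that by (simp add: c_def order_trans[OF _ norm_ge_zero])
    qed
    moreover have "cmod ((\<Sum>h\<leftarrow>L. k a (x (g + h))) / of_nat (length L)
        - (\<Sum>h\<leftarrow>L. k a (x h)) / of_nat (length L)) \<le> D" if "g \<in> K" for g
      using order_trans[OF close[OF that] \<eta>(2)] \<open>D > 0\<close> by (simp add: power2_le_iff_abs_le)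
    ultimately show ?thesis
      using L by blast
  qed
  obtain l where l:
    "((\<lambda>\<alpha>. (1 / measure \<mu> (\<Lambda> \<alpha>)) *\<^sub>R (LINT g:\<Lambda> \<alpha>|\<mu>. k a (x g))) \<longlongrightarrow> l) net_filter"
    "c \<le> cmod l"
    "\<And>\<epsilon>. \<epsilon> > 0 \<Longrightarrow> \<forall>\<^sub>F \<alpha> in net_filter. 0 < emeasure \<mu> (\<Lambda> \<alpha>) \<and>
      (\<forall>h\<in>K. cmod ((1 / measure \<mu> (\<Lambda> \<alpha>)) *\<^sub>R (LINT g:translate h (\<Lambda> \<alpha>)|\<mu>. k a (x g)) - l) < \<epsilon>)"
    using uniform_limit_of_averages[OF filling approx] by blast
  show ?thesis
    unfolding f
  proof (intro exI[of _ l] conjI allI impI l(1))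
    fix \<epsilon> :: real assume "\<epsilon> > 0"
    from eventually_happens'[OF net_filter_neq_bot l(3)[OF this]] obtain \<alpha> where
      pos: "0 < emeasure \<mu> (\<Lambda> \<alpha>)" and
      near: "\<And>h. h \<in> K \<Longrightarrow>
        cmod ((1 / measure \<mu> (\<Lambda> \<alpha>)) *\<^sub>R (LINT g:translate h (\<Lambda> \<alpha>)|\<mu>. k a (x g)) - l) < \<epsilon>"
      by auto
    have large: "cmod l - \<epsilon> <
        cmod ((1 / measure \<mu> (\<Lambda> \<alpha>)) *\<^sub>R (LINT g:translate h (\<Lambda> \<alpha>)|\<mu>. k a (x g)))" if "h \<in> K" for h
      using near[OF that] norm_triangle_ineq3 by (smt (verit) norm_minus_commute)
    have \<Lambda>\<alpha>: "\<Lambda> \<alpha> \<in> sets borel" "\<Lambda> \<alpha> \<subseteq> K" "emeasure \<mu> (\<Lambda> \<alpha>) < \<infinity>"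
      using filling by (auto simp: space_filling_def)
    have "0 < measure \<mu> (\<Lambda> \<alpha>)"
      using pos \<Lambda>\<alpha>(3) by (simp add: measure_def enn2real_positive_iff)
    \<comment> \<open>The translate has the measure of \<open>\<Lambda> \<alpha>\<close>, so the
      normalized integral is a genuine mean over it.\<close>
    then have "\<exists>g\<in>translate h (\<Lambda> \<alpha>). cmod l - \<epsilon> < cmod (k a (x g))" if "h \<in> K" for h
      using \<Lambda>\<alpha> large[OF that] translate_subset[OF \<Lambda>\<alpha>(2) that]
      by (intro exists_large_value)
        (auto simp: borel_translate emeasure_translate[OF haar] measure_translate[OF haar])
    moreover have "c - \<epsilon> \<le> cmod l - \<epsilon>"
      using l(2) by simp
    ultimately have "\<exists>g\<in>translate h (\<Lambda> \<alpha>). c - \<epsilon> < cmod (k a (x g))" if "h \<in> K" for h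
      using that by (meson le_less_trans)
    then have attained: "\<exists>g\<in>translate h (\<Lambda> \<alpha>). cmod (\<omega> A) ^ (2 * q) - \<epsilon> <
        cmod (\<Prod>j=1..q. \<omega> (star A * \<tau> (\<phi> j g) A))" if "h \<in> K" "A = B" for h
      using that by (simp add: f[symmetric] c_def)
    show "\<exists>\<alpha>\<^sub>0. 0 < emeasure \<mu> (\<Lambda> \<alpha>\<^sub>0) \<and>
      (\<forall>h\<in>K. cmod l - \<epsilon> < cmod ((1 / measure \<mu> (\<Lambda> \<alpha>\<^sub>0)) *\<^sub>R
        (LINT g:translate h (\<Lambda> \<alpha>\<^sub>0)|\<mu>. k a (x g)))) \<and>
      (A = B \<longrightarrow> (\<forall>h\<in>K. \<exists>g\<in>translate h (\<Lambda> \<alpha>\<^sub>0).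
        cmod (\<omega> A) ^ (2 * q) - \<epsilon> < cmod (\<Prod>j=1..q. \<omega> (star A * \<tau> (\<phi> j g) A))))"
      using pos large attained by (intro exI[of _ \<alpha>]) blast
  qed
qed

end
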